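(* Consider the following two assertions. (FP) For every nonempty complete metric space $(X,d)$ and every self-mapping $T:X\to X$ that is an $F$-contraction of Hardy-Rogers-type with coefficients $a,b,c,e,\tau,L$, the mapping $T$ has a fixed point; moreover, if $a+e+L\le 1$, then $T$ has a unique fixed point. (BP) Let $(X,d)$ be a complete metric space and let $A,B$ be nonempty closed subsets of $X$ such that $B$ is approximatively compact with respect to $A$. Let $T:A\to B$ be a mapping such that (i) $T(A_0)\subseteq B_0$ and the pair $(A,B)$ has the $p$-property; and (ii) $T$ is a generalized $F$-proximal contraction of the first kind. Then there exists a unique $x\in A$ with $d(x,T(x))=d(A,B)$. Further, for any $x_0\in A_0$, every sequence $\{x_n\}_{n\ge 0}$ in $A$ starting at $x_0$ and satisfying $d(x_{n+1},T(x_n))=d(A,B)$ for all $n\ge 0$ converges to this point $x$. Then: (1) (FP) implies (BP). (2) Under the hypotheses of (BP) on $(X,d)$, $A$, $B$ and $T$, there is a unique $x\in A$ with $d(x,T(x))=d(A,B)$, and for every $x_0\in A_0$ the Picard sequence $\{S^n(x_0)\}_{n\ge 0}$ converges to $x$, where $S:A_0\to A_0$ is the mapping that sends each $u\in A_0$ to the unique $y\in A_0$ with $d(y,T(u))=d(A,B)$.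
   Context: $\mathbb{R}^+$ denotes the set of positive real numbers. $\Omega$ denotes the set of all functions $F:\mathbb{R}^+\to\mathbb{R}$ such that: (i) $F$ is strictly increasing; (ii) for every sequence $\{\alpha_n\}\subset\mathbb{R}^+$, $\lim_{n\to\infty}\alpha_n=0$ if and only if $\lim_{n\to\infty}F(\alpha_n)=-\infty$; (iii) there exists $k\in(0,1)$ with $\lim_{\alpha\to 0^+}\alpha^kF(\alpha)=0$. $F$-contraction of Hardy-Rogers-type: let $(X,d)$ be a metric space. A mapping $T:X\to X$ is an $F$-contraction of Hardy-Rogers-type with coefficients $a,b,c,e,\tau,L$ if there exist $F\in\Omega$ and real numbers $a,b,c,e,\tau>0$, $L\ge 0$ with $a+b+c+2e=1$ and $c\ne 1$ such that for all $x,y\in X$ with $d(Tx,Ty)>0$, $$\tau+F(d(Tx,Ty))\le F\big(a\,d(x,y)+b\,d(x,Tx)+c\,d(y,Ty)+e\,d(x,Ty)+L\,d(y,Tx)\big).$$ For nonempty subsets $A,B$ of a metric space $(X,d)$: $d(A,B)=\inf\{d(x,y):x\in A,\ y\in B\}$; for $x \in X$, $d(x,B)=\inf\{d(x,y):y\in B\}$; $A_0=\{x\in A: d(x,y)=d(A,B)\text{ for some }y\in B\}$; $B_0=\{y\in B: d(x,y)=d(A,B)\text{ for some }x\in A\}$. Generalized $F$-proximal contraction of the first kind: a mapping $T:A\to B$ for which there exist $F\in\Omega$ and real numbers $a,b,c,h,\tau>0$ with $a+b+c+2h=1$ and $c\ne 1$ such that for all $u_1,u_2,x_1,x_2\in A$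 with $u_1\ne u_2$, $d(u_1,T(x_1))=d(A,B)$ and $d(u_2,T(x_2))=d(A,B)$, $$\tau+F(d(u_1,u_2))\le F\big(a\,d(x_1,x_2)+b\,d(u_1,x_1)+c\,d(u_2,x_2)+h\,(d(u_2,x_1)+d(u_1,x_2))\big).$$ Approximative compactness: $B$ is approximatively compact with respect to $A$ if every sequence $\{y_n\}$ in $B$ such that $d(x,y_n)\to d(x,B)$ as $n\to\infty$ for some $x\in A$ has a subsequence converging to a point of $B$. $p$-property: the pair $(A,B)$ has the $p$-property if $A_0\ne\emptyset$ and, for all $u_1,u_2\in A$ and $v_1,v_2\in B$, the equalities $d(u_1,v_1)=d(A,B)$ and $d(u_2,v_2)=d(A,B)$ imply $d(u_1,u_2)=d(v_1,v_2)$. Under $T(A_0)\subseteq B_0$ and the $p$-property, for each $u\in A_0$ there is exactly one $y\in A_0$ with $d(y,T(u))=d(A,B)$, so the mapping $S$ in the claim is well defined. $S^n$ denotes the $n$-fold iterate of $S$, with $S^0$ the identity. *)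

theory Defs
  imports "HOL-Analysis.Analysis"
begin

text \<open>
  Metric spaces are carrier-based (\<^locale>\<open>Metric_space\<close>: a set \<^term>\<open>X\<close> together
  with a distance \<^term>\<open>d\<close>), so that statements can quantify over all metric spaces whose
  points are taken from a given type, in particular over the subspaces of a given space.
  Functions on the positive reals and mappings on a carrier are total functions of which only
  the values on the intended domain are constrained.
\<close>

definition Omega :: "(real \<Rightarrow> real) set" where
  "Omega = {F.
     strict_mono_on {0<..} F \<and>
     (\<forall>\<alpha> :: nat \<Rightarrow> real. (\<forall>n. \<alpha> n > 0) \<longrightarrow>
        (\<alpha> \<longlonglongrightarrow> 0 \<longleftrightarrow> filterlim (\<lambda>n. F (\<alpha> n)) at_bot sequentially)) \<and>
     (\<exists>k. 0 < k \<and> k < 1 \<and> ((\<lambda>\<alpha>. \<alpha> powr k * F \<alpha>) \<longlongrightarrow> 0) (at_right 0))}"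

definition hardy_rogers_F_contraction ::
  "'a set \<Rightarrow> ('a \<Rightarrow> 'a \<Rightarrow> real) \<Rightarrow> ('a \<Rightarrow> 'a)
     \<Rightarrow> real \<Rightarrow> real \<Rightarrow> real \<Rightarrow> real \<Rightarrow> real \<Rightarrow> real \<Rightarrow> bool" where
  "hardy_rogers_F_contraction X d T a b c e \<tau> L \<longleftrightarrow>
     T \<in> X \<rightarrow> X \<and>
     a > 0 \<and> b > 0 \<and> c > 0 \<and> e > 0 \<and> \<tau> > 0 \<and> L \<ge> 0 \<and>
     a + b + c + 2 * e = 1 \<and> c \<noteq> 1 \<and>
     (\<exists>F\<in>Omega. \<forall>x\<in>X. \<forall>y\<in>X. d (T x) (T y) > 0 \<longrightarrow>
        \<tau> + F (d (T x) (T y)) \<le>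
          F (a * d x y + b * d x (T x) + c * d y (T y) + e * d x (T y) + L * d y (T x)))"

definition point_dist :: "('a \<Rightarrow> 'a \<Rightarrow> real) \<Rightarrow> 'a \<Rightarrow> 'a set \<Rightarrow> real" where
  "point_dist d x B = Inf {d x y | y. y \<in> B}"

definition set_dist :: "('a \<Rightarrow> 'a \<Rightarrow> real) \<Rightarrow> 'a set \<Rightarrow> 'a set \<Rightarrow> real" where
  "set_dist d A B = Inf {d x y | x y. x \<in> A \<and> y \<in> B}"

definition proximal_left :: "('a \<Rightarrow> 'a \<Rightarrow> real) \<Rightarrow> 'a set \<Rightarrow> 'a set \<Rightarrow> 'a set" where
  \<comment> \<open>the set written \<open>A\<^sub>0\<close>\<close>
  "proximal_left d A B = {x \<in> A. \<exists>y\<in>B. d x y = set_dist d A B}"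

definition proximal_right :: "('a \<Rightarrow> 'a \<Rightarrow> real) \<Rightarrow> 'a set \<Rightarrow> 'a set \<Rightarrow> 'a set" where
  \<comment> \<open>the set written \<open>B\<^sub>0\<close>\<close>
  "proximal_right d A B = {y \<in> B. \<exists>x\<in>A. d x y = set_dist d A B}"

definition F_proximal_contraction_first_kind ::
  "('a \<Rightarrow> 'a \<Rightarrow> real) \<Rightarrow> 'a set \<Rightarrow> 'a set \<Rightarrow> ('a \<Rightarrow> 'a) \<Rightarrow> bool" where
  "F_proximal_contraction_first_kind d A B T \<longleftrightarrow>
     T \<in> A \<rightarrow> B \<and>
     (\<exists>F\<in>Omega. \<exists>a b c h \<tau>.
        a > 0 \<and> b > 0 \<and> c > 0 \<and> h > 0 \<and> \<tau> > 0 \<and>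
        a + b + c + 2 * h = 1 \<and> c \<noteq> 1 \<and>
        (\<forall>u1\<in>A. \<forall>u2\<in>A. \<forall>x1\<in>A. \<forall>x2\<in>A.
           u1 \<noteq> u2 \<longrightarrow> d u1 (T x1) = set_dist d A B \<longrightarrow> d u2 (T x2) = set_dist d A B \<longrightarrow>
           \<tau> + F (d u1 u2) \<le>
             F (a * d x1 x2 + b * d u1 x1 + c * d u2 x2 + h * (d u2 x1 + d u1 x2))))"

definition approximatively_compact_wrt ::
  "'a set \<Rightarrow> ('a \<Rightarrow> 'a \<Rightarrow> real) \<Rightarrow> 'a set \<Rightarrow> 'a set \<Rightarrow> bool" where
  \<comment> \<open>\<open>B\<close> is approximatively compact with respect to \<open>A\<close>, in the metric space \<open>(X, d)\<close>\<close>
  "approximatively_compact_wrt X d B A \<longleftrightarrow>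
     (\<forall>y :: nat \<Rightarrow> 'a.
        (\<forall>n. y n \<in> B) \<and> (\<exists>x\<in>A. (\<lambda>n. d x (y n)) \<longlonglongrightarrow> point_dist d x B) \<longrightarrow>
        (\<exists>r l. strict_mono (r :: nat \<Rightarrow> nat) \<and> l \<in> B \<and>
           limitin (Metric_space.mtopology X d) (y \<circ> r) l sequentially))"

definition p_property :: "('a \<Rightarrow> 'a \<Rightarrow> real) \<Rightarrow> 'a set \<Rightarrow> 'a set \<Rightarrow> bool" where
  "p_property d A B \<longleftrightarrow>
     proximal_left d A B \<noteq> {} \<and>
     (\<forall>u1\<in>A. \<forall>u2\<in>A. \<forall>v1\<in>B. \<forall>v2\<in>B.
        d u1 v1 = set_dist d A B \<longrightarrow> d u2 v2 = set_dist d A B \<longrightarrow> d u1 u2 = d v1 v2)"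

definition best_proximity_hypotheses ::
  "'a set \<Rightarrow> ('a \<Rightarrow> 'a \<Rightarrow> real) \<Rightarrow> 'a set \<Rightarrow> 'a set \<Rightarrow> ('a \<Rightarrow> 'a) \<Rightarrow> bool" where
  "best_proximity_hypotheses X d A B T \<longleftrightarrow>
     Metric_space X d \<and> Metric_space.mcomplete X d \<and>
     A \<noteq> {} \<and> B \<noteq> {} \<and>
     closedin (Metric_space.mtopology X d) A \<and> closedin (Metric_space.mtopology X d) B \<and>
     approximatively_compact_wrt X d B A \<and>
     T \<in> A \<rightarrow> B \<and>
     T ` proximal_left d A B \<subseteq> proximal_right d A B \<and> p_property d A B \<and>
     F_proximal_contraction_first_kind d A B T"

text \<open>
  The two assertions, for all metric spaces whose points are taken from the type \<^typ>\<open>'a\<close>.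
\<close>

definition FP_assertion :: "'a itself \<Rightarrow> bool" where
  "FP_assertion (_ :: 'a itself) \<longleftrightarrow>
     (\<forall>(X :: 'a set) d T a b c e \<tau> L.
        X \<noteq> {} \<and> Metric_space X d \<and> Metric_space.mcomplete X d \<and>
        hardy_rogers_F_contraction X d T a b c e \<tau> L \<longrightarrow>
        (\<exists>x\<in>X. T x = x) \<and>
        (a + e + L \<le> 1 \<longrightarrow> (\<exists>!x. x \<in> X \<and> T x = x)))"

definition BP_assertion :: "'a itself \<Rightarrow> bool" where
  "BP_assertion (_ :: 'a itself) \<longleftrightarrow>
     (\<forall>(X :: 'a set) d A B T.
        best_proximity_hypotheses X d A B T \<longrightarrow>
        (\<exists>!x. x \<in> A \<and> d x (T x) = set_dist d A B) \<and>
        (\<forall>x\<in>A. d x (T x) = set_dist d A B \<longrightarrow>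
           (\<forall>x0\<in>proximal_left d A B. \<forall>xs :: nat \<Rightarrow> 'a.
              (\<forall>n. xs n \<in> A) \<and> xs 0 = x0 \<and> (\<forall>n. d (xs (Suc n)) (T (xs n)) = set_dist d A B) \<longrightarrow>
              limitin (Metric_space.mtopology X d) xs x sequentially)))"

definition proximal_map ::
  "('a \<Rightarrow> 'a \<Rightarrow> real) \<Rightarrow> 'a set \<Rightarrow> 'a set \<Rightarrow> ('a \<Rightarrow> 'a) \<Rightarrow> 'a \<Rightarrow> 'a" where
  \<comment> \<open>the mapping \<open>S\<close>; meaningful on \<open>A\<^sub>0\<close> by the lemma below\<close>
  "proximal_map d A B T u =
     (THE y. y \<in> proximal_left d A B \<and> d y (T u) = set_dist d A B)"

lemma proximal_map_well_defined:
  assumes "Metric_space X d" "A \<subseteq> X" "B \<subseteq> X" "T \<in> A \<rightarrow> B"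
    and img: "T ` proximal_left d A B \<subseteq> proximal_right d A B" and p: "p_property d A B"
    and u: "u \<in> proximal_left d A B"
  shows "\<exists>!y. y \<in> proximal_left d A B \<and> d y (T u) = set_dist d A B"
proof -
  interpret Metric_space X d by fact
  have Tu: "T u \<in> proximal_right d A B" using img u by blast
  then have TuB: "T u \<in> B" by (simp add: proximal_right_def)
  obtain y where y: "y \<in> A" "d y (T u) = set_dist d A B"
    using Tu by (auto simp: proximal_right_def)
  show ?thesis
  proof (rule ex1I[of _ y])
    show "y \<in> proximal_left d A B \<and> d y (T u) = set_dist d A B"
      using y TuB by (auto simp: proximal_left_def)
  next
    fix z assume z: "z \<in> proximal_left d A B \<and> d z (T u) = set_dist d A B"
    then have zA: "z \<in> A" by (simp add: proximal_left_def)
    have "d z y = d (T u) (T u)"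
      using p z zA y TuB unfolding p_property_def by blast
    moreover have "d (T u) (T u) = 0" using TuB assms(3) by auto
    ultimately show "z = y" using zA y assms(2) zero[of z y] by (simp add: subset_eq)
  qed
qed

end

theory Submission
  imports Defs
begin

text \<open>
  Along a proximal sequence the successive distances \<open>\<delta>\<^sub>n = d x\<^sub>n x\<^sub>n\<^sub>+\<^sub>1\<close> satisfy
  \<open>\<tau> + F \<delta>\<^sub>n\<^sub>+\<^sub>1 \<le> F \<delta>\<^sub>n\<close> as long as they do not vanish, so \<open>F \<delta>\<^sub>n \<le> F \<delta>\<^sub>0 - n \<tau>\<close>; multiplying by
  \<open>\<delta>\<^sub>n\<^sup>k\<close> and using condition (iii) on \<open>F\<close> gives \<open>n \<delta>\<^sub>n\<^sup>k \<rightarrow> 0\<close>, whence \<open>\<Sum> \<delta>\<^sub>n\<close> converges and the sequence is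
  Cauchy.  By the \<open>p\<close>-property the images \<open>T x\<^sub>n\<close> are Cauchy as well, so the limit \<open>x\<close> lies in \<open>A\<^sub>0\<close>
  and some \<open>u\<close> is proximal to \<open>T x\<close>.  Comparing \<open>x\<^sub>n\<^sub>+\<^sub>1\<close> with \<open>u\<close> by the contraction inequality and
  passing to the limit yields \<open>d x u \<le> (c + h) d x u\<close>, so \<open>u = x\<close>.  This proves (BP) outright,
  without an appeal to (FP).
\<close>

section \<open>Summability from a fixed decrease of \<open>F\<close>\<close>

lemma Omega_less_iff:
  assumes "F \<in> Omega" "0 < x" "0 < y"
  shows "F x < F y \<longleftrightarrow> x < y"
  using assms strict_mono_on_less[of "{0<..}" F x y] by (auto simp: Omega_def)

lemma Omega_summable:
  assumes F: "F \<in> Omega" and \<tau>: "0 < \<tau>" and pos: "\<And>n. 0 < \<delta> n"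
    and step: "\<And>n. \<tau> + F (\<delta> (Suc n)) \<le> F (\<delta> n)"
  shows "summable \<delta>"
proof -
  obtain k where k: "0 < k" "k < 1" and lim: "((\<lambda>\<alpha>. \<alpha> powr k * F \<alpha>) \<longlongrightarrow> 0) (at_right 0)"
    using F by (auto simp: Omega_def)
  have le: "F (\<delta> n) \<le> F (\<delta> 0) - real n * \<tau>" for n
  proof (induction n)
    case (Suc n)
    then show ?case using step[of n] by (simp add: algebra_simps)
  qed simp
  \<comment> \<open>The linear upper bound drives \<open>F (\<delta> n)\<close> to minus infinity,
    and condition (ii) turns this into \<open>\<delta>\<close> tending to 0. Positivity makes the
    approach right-sided, as the limit in condition (iii) requires.\<close>
  have "filterlim (\<lambda>n. \<tau> * real n) at_top sequentially"
    by (rule filterlim_tendsto_pos_mult_at_top[OF tendsto_const \<tau> filterlim_real_sequentially])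
  then have "filterlim (\<lambda>n. - F (\<delta> 0) + \<tau> * real n) at_top sequentially"
    by (rule filterlim_tendsto_add_at_top[OF tendsto_const])
  then have "filterlim (\<lambda>n. F (\<delta> 0) - real n * \<tau>) at_bot sequentially"
    by (simp add: filterlim_uminus_at_top mult.commute)
  then have "filterlim (\<lambda>n. F (\<delta> n)) at_bot sequentially"
    by (rule filterlim_at_bot_mono) (use le in auto)
  then have \<delta>0: "\<delta> \<longlonglongrightarrow> 0"
    using F pos by (auto simp: Omega_def)
  then have "filterlim \<delta> (at_right 0) sequentially"
    using pos by (auto simp: filterlim_at less_imp_neq[symmetric])
  then have 1: "(\<lambda>n. \<delta> n powr k * F (\<delta> n)) \<longlonglongrightarrow> 0"
    by (rule filterlim_compose[OF lim])
  have "(\<lambda>n. \<delta> n powr k) \<longlonglongrightarrow> 0"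
    using tendsto_powr'[OF \<delta>0 tendsto_const[of k]] k pos
    by (simp add: less_imp_le always_eventually)
  then have "(\<lambda>n. \<delta> n powr k * F (\<delta> 0) - \<delta> n powr k * F (\<delta> n)) \<longlonglongrightarrow> 0 * F (\<delta> 0) - 0"
    by (intro tendsto_intros 1)
  \<comment> \<open>The difference dominates \<open>\<delta> n powr k * (real n * \<tau>)\<close>,
    so the threshold \<open>\<tau>\<close> cancels and leaves
    \<open>\<delta> n powr k * real n < 1\<close>.\<close>
  then have "\<forall>\<^sub>F n in sequentially. \<delta> n powr k * F (\<delta> 0) - \<delta> n powr k * F (\<delta> n) < \<tau>"
    using \<tau> by (simp add: order_tendstoD(2))
  then have "\<forall>\<^sub>F n in sequentially. norm (\<delta> n) \<le> real n powr (- 1 / k)"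
    using eventually_gt_at_top[of 0]
  proof eventually_elim
    case (elim n)
    have "\<delta> n powr k * (real n * \<tau>) \<le> \<delta> n powr k * (F (\<delta> 0) - F (\<delta> n))"
      using le[of n] by (intro mult_left_mono) auto
    then have "(\<delta> n powr k * real n) * \<tau> < 1 * \<tau>"
      using elim by (simp add: algebra_simps)
    then have "\<delta> n powr k \<le> 1 / real n"
      using \<tau> elim by (simp add: field_simps)
    then have "(\<delta> n powr k) powr (1 / k) \<le> (1 / real n) powr (1 / k)"
      using k by (intro powr_mono2) auto
    then show ?case
      using k pos[of n] elim by (simp add: powr_powr powr_divide powr_minus_divide less_imp_le)
  qed
  \<comment> \<open>A convergent p-series, since \<open>k < 1\<close> gives exponent
    \<open>1 / k > 1\<close>.\<close>
  moreover have "summable (\<lambda>n. real n powr (- 1 / k))"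
    using k by (simp add: summable_real_powr_iff field_simps)
  ultimately show ?thesis
    by (rule summable_comparison_test_ev)
qed

section \<open>The contraction inequality with \<open>F\<close> and its coefficients fixed\<close>

definition F_proximal_contraction_with ::
  "(real \<Rightarrow> real) \<Rightarrow> real \<Rightarrow> real \<Rightarrow> real \<Rightarrow> real \<Rightarrow> real
     \<Rightarrow> ('a \<Rightarrow> 'a \<Rightarrow> real) \<Rightarrow> 'a set \<Rightarrow> 'a set \<Rightarrow> ('a \<Rightarrow> 'a) \<Rightarrow> bool" where
  "F_proximal_contraction_with F a b c h \<tau> d A B T \<longleftrightarrow>
     F \<in> Omega \<and> a > 0 \<and> b > 0 \<and> c > 0 \<and> h > 0 \<and> \<tau> > 0 \<and> a + b + c + 2 * h = 1 \<and>
     (\<forall>u\<in>A. \<forall>v\<in>A. \<forall>x\<in>A. \<forall>y\<in>A.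
        u \<noteq> v \<longrightarrow> d u (T x) = set_dist d A B \<longrightarrow> d v (T y) = set_dist d A B \<longrightarrow>
        \<tau> + F (d u v) \<le> F (a * d x y + b * d u x + c * d v y + h * (d v x + d u y)))"

lemma F_proximal_contraction_first_kindE:
  assumes "F_proximal_contraction_first_kind d A B T"
  obtains F a b c h \<tau> where "F_proximal_contraction_with F a b c h \<tau> d A B T"
proof -
  have "\<exists>F a b c h \<tau>. F_proximal_contraction_with F a b c h \<tau> d A B T"
    using assms
    unfolding F_proximal_contraction_first_kind_def F_proximal_contraction_with_def Bex_def
    by (elim conjE exE) (intro exI conjI; assumption)
  then show ?thesis using that by blast
qed

section \<open>Metric consequences: uniqueness and the Cauchy property\<close>

context Metric_space
begin

text \<open>The iterated triangle inequality bounds \<open>d (x m) (x n)\<close> by a block of the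
  series, which the Cauchy criterion makes small.\<close>

lemma MCauchy_if_summable:
  assumes x: "\<And>n. x n \<in> M" and s: "summable (\<lambda>n. d (x n) (x (Suc n)))"
  shows "MCauchy x"
  unfolding MCauchy_def
proof (intro conjI allI impI)
  show "range x \<subseteq> M" using x by auto
  fix \<epsilon> :: real assume "0 < \<epsilon>"
  then obtain N where N: "\<And>m n. N \<le> m \<Longrightarrow> norm (\<Sum>i=m..<n. d (x i) (x (Suc i))) < \<epsilon>"
    using s unfolding summable_Cauchy by blast
  have tel: "d (x m) (x (m + j)) \<le> (\<Sum>i=m..<m+j. d (x i) (x (Suc i)))" for m j
  proof (induction j)
    case (Suc j)
    then show ?case
      using triangle[of "x m" "x (m + j)" "x (Suc (m + j))"] x by simp
  qed (simp add: x)
  have "d (x m) (x n) < \<epsilon>" if "N \<le> m" "m \<le> n" for m n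
    using tel[of m "n - m"] N[OF that(1), of n] that by simp
  then show "\<exists>N. \<forall>n n'. N \<le> n \<longrightarrow> N \<le> n' \<longrightarrow> d (x n) (x n') < \<epsilon>"
    by (metis commute linear)
qed

lemma limitin_imp_tendsto_dist:
  assumes x: "limitin mtopology x l sequentially" and y: "limitin mtopology y m sequentially"
    and "\<And>n. x n \<in> M" "\<And>n. y n \<in> M"
  shows "(\<lambda>n. d (x n) (y n)) \<longlonglongrightarrow> d l m"
proof -
  have l: "l \<in> M" "(\<lambda>n. d (x n) l) \<longlonglongrightarrow> 0" and m: "m \<in> M" "(\<lambda>n. d (y n) m) \<longlonglongrightarrow> 0"
    using x y by (auto simp: limitin_metric_dist_null)
  have "(\<lambda>n. d (x n) (y n) - d l m) \<longlonglongrightarrow> 0"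
  proof (rule Lim_null_comparison)
    show "(\<lambda>n. d (x n) l + d (y n) m) \<longlonglongrightarrow> 0"
      using tendsto_add[OF l(2) m(2)] by simp
    show "\<forall>\<^sub>F n in sequentially. norm (d (x n) (y n) - d l m) \<le> d (x n) l + d (y n) m"
    proof (intro always_eventually allI)
      fix n
      have "d (x n) (y n) \<le> d (x n) l + d l m + d m (y n)"
        "d l m \<le> d l (x n) + d (x n) (y n) + d (y n) m"
        using assms(3,4) l(1) m(1) triangle by (smt (verit))+
      then show "norm (d (x n) (y n) - d l m) \<le> d (x n) l + d (y n) m"
        by (simp add: commute)
    qed
  qed
  then show ?thesis by (simp add: LIM_zero_iff)
qed

text \<open>Strips \<open>F\<close> from the inequality. Monotonicity of \<open>F\<close> is
  available only on positive reals, so the work lies in showing that the right-hand argument is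
  positive.\<close>

lemma F_proximal_contraction_with_less:
  assumes "F_proximal_contraction_with F a b c h \<tau> d A B T" and A: "A \<subseteq> M"
    and *: "u \<in> A" "v \<in> A" "x \<in> A" "y \<in> A" "u \<noteq> v"
       "d u (T x) = set_dist d A B" "d v (T y) = set_dist d A B"
  shows "d u v < a * d x y + b * d u x + c * d v y + h * (d v x + d u y)"
    and "\<tau> + F (d u v) \<le> F (a * d x y + b * d u x + c * d v y + h * (d v x + d u y))"
proof -
  let ?m = "a * d x y + b * d u x + c * d v y + h * (d v x + d u y)"
  have F: "F \<in> Omega" and co: "a > 0" "b > 0" "c > 0" "h > 0" "\<tau> > 0"
    and le: "\<tau> + F (d u v) \<le> F ?m"
    using assms(1) * unfolding F_proximal_contraction_with_def by blast+
  have M: "u \<in> M" "v \<in> M" "x \<in> M" "y \<in> M" using * A by auto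
  have "0 < d u v" using M * by (simp add: mdist_pos_less)
  \<comment> \<open>The distinct points \<open>u\<close> and \<open>v\<close> cannot both equal
    \<open>x\<close>; the coefficients \<open>b\<close> and \<open>h\<close> carry the positive
    distance into \<open>?m\<close>.\<close>
  then have "0 < d u x \<or> 0 < d v x"
    using triangle[of u x v] M commute[of x v] by (smt (verit) nonneg)
  moreover have "0 \<le> a * d x y" "0 \<le> c * d v y" "0 \<le> h * d u y" "0 \<le> b * d u x" "0 \<le> h * d v x"
    using co by auto
  moreover have "0 < d u x \<Longrightarrow> 0 < b * d u x" "0 < d v x \<Longrightarrow> 0 < h * d v x"
    using co by auto
  ultimately have "0 < ?m"
    unfolding distrib_left by linarith
  then show "d u v < ?m"
    using Omega_less_iff[OF F \<open>0 < d u v\<close>] le co by force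
  show "\<tau> + F (d u v) \<le> F ?m" by (fact le)
qed

lemma best_proximity_point_unique:
  assumes "F_proximal_contraction_first_kind d A B T" "A \<subseteq> M"
    and "x \<in> A" "d x (T x) = set_dist d A B" "y \<in> A" "d y (T y) = set_dist d A B"
  shows "x = y"
proof (rule ccontr)
  assume "x \<noteq> y"
  obtain F a b c h \<tau> where with_coeffs: "F_proximal_contraction_with F a b c h \<tau> d A B T"
    using F_proximal_contraction_first_kindE[OF assms(1)] by blast
  then have co: "a > 0" "b > 0" "c > 0" "h > 0" "a + b + c + 2 * h = 1"
    by (auto simp: F_proximal_contraction_with_def)
  note ineq = F_proximal_contraction_with_less[OF with_coeffs assms(2)]
  have M: "x \<in> M" "y \<in> M" using assms by auto
  \<comment> \<open>With \<open>u = x\<close> and \<open>v = y\<close> the terms in \<open>b\<close>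
    and \<open>c\<close> vanish, and both cross distances become \<open>d x y\<close>.\<close>
  have "1 * d x y < (a + 2 * h) * d x y"
    using ineq[of x y x y] assms \<open>x \<noteq> y\<close> M by (simp add: commute algebra_simps)
  also have "\<dots> \<le> 1 * d x y"
    using co by (intro mult_right_mono) auto
  finally show False by simp
qed

lemma proximal_sequence_MCauchy:
  assumes "F_proximal_contraction_first_kind d A B T" and A: "A \<subseteq> M"
    and x: "\<And>n. x n \<in> A" and prox: "\<And>n. d (x (Suc n)) (T (x n)) = set_dist d A B"
  shows "MCauchy x"
proof -
  obtain F a b c h \<tau> where with_coeffs: "F_proximal_contraction_with F a b c h \<tau> d A B T"
    using F_proximal_contraction_first_kindE[OF assms(1)] by blast
  then have F: "F \<in> Omega"
    and co: "a > 0" "b > 0" "c > 0" "h > 0" "\<tau> > 0" "a + b + c + 2 * h = 1"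
    by (auto simp: F_proximal_contraction_with_def)
  note ineq = F_proximal_contraction_with_less[OF with_coeffs assms(2)]
  have M: "x n \<in> M" for n using x A by auto
  define \<delta> where "\<delta> n = d (x n) (x (Suc n))" for n
  have nonneg: "0 \<le> \<delta> n" for n by (simp add: \<delta>_def)
  have key: "0 < \<delta> n \<and> \<tau> + F (\<delta> (Suc n)) \<le> F (\<delta> n)" if "0 < \<delta> (Suc n)" for n
  proof -
    define m where "m = a * \<delta> n + b * \<delta> n + c * \<delta> (Suc n) + h * d (x n) (x (Suc (Suc n)))"
    \<comment> \<open>The cross distance \<open>d u y\<close> is 0 here, since \<open>u\<close> and
      \<open>y\<close> are both \<open>x (Suc n)\<close>.\<close>
    have m: "\<tau> + F (\<delta> (Suc n)) \<le> F m" "\<delta> (Suc n) < m"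
      using ineq[of "x (Suc n)" "x (Suc (Suc n))" "x n" "x (Suc n)"] that M x prox
      by (auto simp: \<delta>_def m_def commute)
    have "h * d (x n) (x (Suc (Suc n))) \<le> h * (\<delta> n + \<delta> (Suc n))"
      unfolding \<delta>_def using co M triangle by (intro mult_left_mono) auto
    then have mle: "m \<le> (a + b + h) * \<delta> n + (c + h) * \<delta> (Suc n)"
      by (simp add: m_def algebra_simps)
    \<comment> \<open>The bound on \<open>m\<close> is thus a convex combination of
      \<open>\<delta> n\<close> and \<open>\<delta> (Suc n)\<close>. As it exceeds
      \<open>\<delta> (Suc n)\<close>, it follows that \<open>\<delta> (Suc n) < \<delta> n\<close>,
      and so \<open>m \<le> \<delta> n\<close>.\<close>
    have ch: "c + h = 1 - (a + b + h)" using co by simp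
    have "(a + b + h) * \<delta> (Suc n) < (a + b + h) * \<delta> n"
      using m(2) mle unfolding ch by (simp add: algebra_simps)
    then have lt: "\<delta> (Suc n) < \<delta> n" using co by simp
    have "(c + h) * \<delta> (Suc n) \<le> (c + h) * \<delta> n"
      using lt co by (intro mult_left_mono) auto
    then have "m \<le> \<delta> n" using mle unfolding ch by (simp add: algebra_simps)
    then have "F m \<le> F (\<delta> n)"
      using Omega_less_iff[OF F, of "\<delta> n" m] that lt m(2) by force
    then show ?thesis using m(1) that lt by linarith
  qed
  have "summable \<delta>"
  proof (cases "\<forall>n. 0 < \<delta> n")
    case True
    then show ?thesis using Omega_summable[OF F co(5)] key by blast
  next
    \<comment> \<open>By the contrapositive of \<open>key\<close>, a zero step is followed only by
      zero steps, so the series has finitely many nonzero terms.\<close>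
    case False
    then obtain N where N: "\<delta> N = 0" using nonneg by (metis less_eq_real_def)
    have "\<delta> (N + j) = 0" for j
    proof (induction j)
      case (Suc j)
      then show ?case using key[of "N + j"] nonneg[of "Suc (N + j)"] by force
    qed (simp add: N)
    then have "\<delta> n = 0" if "N \<le> n" for n using that by (metis le_add_diff_inverse)
    then show ?thesis by (intro summable_finite[of "{..<N}"]) auto
  qed
  then show ?thesis
    unfolding \<delta>_def by (intro MCauchy_if_summable M)
qed

end

section \<open>Limits of proximal sequences and best proximity points\<close>

lemma proximal_sequence_limit:
  assumes hyp: "best_proximity_hypotheses X d A B T"
    and x: "\<And>n. x n \<in> A" and prox: "\<And>n. d (x (Suc n)) (T (x n)) = set_dist d A B"
  obtains l where "l \<in> A" "d l (T l) = set_dist d A B"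
    "limitin (Metric_space.mtopology X d) x l sequentially"
proof -
  interpret Metric_space X d
    using hyp by (simp add: best_proximity_hypotheses_def)
  let ?D = "set_dist d A B"
  have comp: mcomplete and clA: "closedin mtopology A" and clB: "closedin mtopology B"
    and TAB: "T \<in> A \<rightarrow> B" and T0: "T ` proximal_left d A B \<subseteq> proximal_right d A B"
    and p: "p_property d A B" and contr: "F_proximal_contraction_first_kind d A B T"
    using hyp by (auto simp: best_proximity_hypotheses_def)
  have A: "A \<subseteq> X" and B: "B \<subseteq> X"
    using clA clB by (auto simp: metric_closedin_iff_sequentially_closed)
  have xX: "x n \<in> X" and TxB: "T (x n) \<in> B" and TxX: "T (x n) \<in> X" for n
    using x A B TAB by auto
  have cau: "MCauchy x"
    using proximal_sequence_MCauchy[OF contr A] x prox by blast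
  then obtain l where l: "limitin mtopology x l sequentially"
    using comp by (auto simp: mcomplete_def)
  have lA: "l \<in> A"
    by (rule limitin_closedin[OF l clA]) (use x in auto)
  have lS: "limitin mtopology (\<lambda>n. x (Suc n)) l sequentially"
    using l limitin_sequentially_offset[of mtopology x l 1] by simp
  \<comment> \<open>The \<open>p\<close>-property transfers the Cauchy property to the images
    without any continuity of \<open>T\<close>; their limit \<open>y\<close> only serves to place
    \<open>l\<close> in \<open>proximal_left d A B\<close>.\<close>
  have "d (T (x m)) (T (x n)) = d (x (Suc m)) (x (Suc n))" for m n
    using p x TxB prox unfolding p_property_def by metis
  moreover have "\<exists>N. \<forall>m n. N \<le> m \<longrightarrow> N \<le> n \<longrightarrow> d (x (Suc m)) (x (Suc n)) < \<epsilon>" if "0 < \<epsilon>" for \<epsilon>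
    using cau that unfolding MCauchy_def by (meson le_Suc_eq)
  ultimately have "MCauchy (\<lambda>n. T (x n))"
    using TxX by (auto simp: MCauchy_def)
  then obtain y where y: "limitin mtopology (\<lambda>n. T (x n)) y sequentially"
    using comp by (auto simp: mcomplete_def)
  have yB: "y \<in> B"
    by (rule limitin_closedin[OF y clB]) (use TxB in auto)
  have "(\<lambda>n. d (x (Suc n)) (T (x n))) \<longlonglongrightarrow> d l y"
    by (intro limitin_imp_tendsto_dist lS y xX TxX)
  then have "d l y = ?D" by (simp add: prox LIMSEQ_const_iff)
  then have "T l \<in> proximal_right d A B"
    using T0 lA yB by (auto simp: proximal_left_def)
  then obtain u where u: "u \<in> A" "d u (T l) = ?D"
    by (auto simp: proximal_right_def)
  obtain F a b c h \<tau> where with_coeffs: "F_proximal_contraction_with F a b c h \<tau> d A B T"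
    using F_proximal_contraction_first_kindE[OF contr] by blast
  then have co: "a > 0" "b > 0" "c > 0" "h > 0" "a + b + c + 2 * h = 1"
    by (auto simp: F_proximal_contraction_with_def)
  note ineq = F_proximal_contraction_with_less[OF with_coeffs A]
  have lX: "l \<in> X" and uX: "u \<in> X" using lA u A by auto
  \<comment> \<open>The weak inequality also covers \<open>x (Suc n) = u\<close>, where the
    contraction condition is silent, so it holds for every \<open>n\<close>.\<close>
  have le: "d (x (Suc n)) u \<le> a * d (x n) l + b * d (x (Suc n)) (x n) + c * d u l
      + h * (d u (x n) + d (x (Suc n)) l)" for n
  proof (cases "x (Suc n) = u")
    case True
    then show ?thesis using co uX by simp
  next
    case False
    then show ?thesis using ineq[of "x (Suc n)" u "x n" l] x prox u lA by auto
  qed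
  have const: "limitin mtopology (\<lambda>n. l) l sequentially" "limitin mtopology (\<lambda>n. u) u sequentially"
    using lX uX by auto
  note lims = limitin_imp_tendsto_dist[OF lS const(2) xX uX]
    limitin_imp_tendsto_dist[OF l const(1) xX lX] limitin_imp_tendsto_dist[OF lS l xX xX]
    limitin_imp_tendsto_dist[OF const(2) l uX xX] limitin_imp_tendsto_dist[OF lS const(1) xX lX]
  have "(\<lambda>n. a * d (x n) l + b * d (x (Suc n)) (x n) + c * d u l
      + h * (d u (x n) + d (x (Suc n)) l)) \<longlonglongrightarrow>
      a * d l l + b * d l l + c * d u l + h * (d u l + d l l)"
    by (intro tendsto_intros lims)
  then have "d l u \<le> a * d l l + b * d l l + c * d u l + h * (d u l + d l l)"
    by (rule LIMSEQ_le[OF lims(1)]) (use le in auto)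
  \<comment> \<open>Only the terms with \<open>d u l\<close> survive in the limit;
    \<open>1 - c - h\<close> equals \<open>a + b + h\<close>.\<close>
  then have "(1 - c - h) * d l u \<le> 0"
    using lX commute[of u l] by (simp add: algebra_simps)
  moreover have "0 < 1 - c - h" using co by linarith
  ultimately have "d l u \<le> 0" by (simp add: mult_le_0_iff)
  then have "u = l" using lX uX by (metis nonneg order_antisym zero)
  then show ?thesis using that l lA u by blast
qed

text \<open>The third claim makes orbits of \<open>proximal_map\<close> proximal sequences. An orbit
  from a point of the nonempty \<open>proximal_left d A B\<close> gives existence, and the same
  claim later brings Picard sequences under the second.\<close>

lemma best_proximity_point:
  assumes hyp: "best_proximity_hypotheses X d A B T"
  shows "\<exists>!x. x \<in> A \<and> d x (T x) = set_dist d A B"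
    and "\<And>x xs. \<lbrakk>x \<in> A; d x (T x) = set_dist d A B; \<And>n. xs n \<in> A;
           \<And>n. d (xs (Suc n)) (T (xs n)) = set_dist d A B\<rbrakk> \<Longrightarrow>
           limitin (Metric_space.mtopology X d) xs x sequentially"
    and "\<And>x0 n. x0 \<in> proximal_left d A B \<Longrightarrow>
           (proximal_map d A B T ^^ n) x0 \<in> A \<and>
           d ((proximal_map d A B T ^^ Suc n) x0) (T ((proximal_map d A B T ^^ n) x0))
             = set_dist d A B"
proof -
  interpret Metric_space X d
    using hyp by (simp add: best_proximity_hypotheses_def)
  let ?S = "proximal_map d A B T"
  have A: "A \<subseteq> X" and B: "B \<subseteq> X"
    using hyp by (auto simp: best_proximity_hypotheses_def metric_closedin_iff_sequentially_closed)
  have S: "?S u \<in> proximal_left d A B \<and> d (?S u) (T u) = set_dist d A B"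
    if "u \<in> proximal_left d A B" for u
    unfolding proximal_map_def
    by (rule theI', rule proximal_map_well_defined[OF Metric_space_axioms A B])
      (use hyp that in \<open>auto simp: best_proximity_hypotheses_def\<close>)
  have mem: "(?S ^^ n) x0 \<in> proximal_left d A B" if "x0 \<in> proximal_left d A B" for x0 n
    using S that by (induction n) auto
  then show orbit: "(?S ^^ n) x0 \<in> A \<and>
       d ((?S ^^ Suc n) x0) (T ((?S ^^ n) x0)) = set_dist d A B"
    if "x0 \<in> proximal_left d A B" for x0 n
    using S[OF mem[OF that]] that by (auto simp: proximal_left_def)
  have contr: "F_proximal_contraction_first_kind d A B T"
    and "proximal_left d A B \<noteq> {}"
    using hyp by (auto simp: best_proximity_hypotheses_def p_property_def)
  then obtain x0 where "x0 \<in> proximal_left d A B" by blast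
  then obtain l where l: "l \<in> A" "d l (T l) = set_dist d A B"
    using proximal_sequence_limit[OF hyp, of "\<lambda>n. (?S ^^ n) x0"] orbit by metis
  show "\<exists>!x. x \<in> A \<and> d x (T x) = set_dist d A B"
    using l best_proximity_point_unique[OF contr A] by metis
  fix x xs
  assume "x \<in> A" "d x (T x) = set_dist d A B" "\<And>n. xs n \<in> A"
    "\<And>n. d (xs (Suc n)) (T (xs n)) = set_dist d A B"
  \<comment> \<open>The sequence converges to some best proximity point, which uniqueness identifies
    with \<open>x\<close>.\<close>
  then show "limitin mtopology xs x sequentially"
    using proximal_sequence_limit[OF hyp, of xs] best_proximity_point_unique[OF contr A] by metis
qed

theorem theorem2p9:
  shows "(FP_assertion TYPE('a) \<longrightarrow> BP_assertion TYPE('a)) \<and>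
    (\<forall>(X :: 'a set) d A B T.
       best_proximity_hypotheses X d A B T \<longrightarrow>
       (\<exists>!x. x \<in> A \<and> d x (T x) = set_dist d A B) \<and>
       (\<forall>x\<in>A. d x (T x) = set_dist d A B \<longrightarrow>
          (\<forall>x0\<in>proximal_left d A B.
             limitin (Metric_space.mtopology X d)
               (\<lambda>n. (proximal_map d A B T ^^ n) x0) x sequentially)))"
proof (intro conjI impI allI ballI)
  show "BP_assertion TYPE('a)"
    unfolding BP_assertion_def
  proof (intro allI impI conjI ballI)
    fix X :: "'a set" and d A B T
    assume hyp: "best_proximity_hypotheses X d A B T"
    show "\<exists>!x. x \<in> A \<and> d x (T x) = set_dist d A B"
      using best_proximity_point(1)[OF hyp] .
    fix x x0 xs
    assume "x \<in> A" "d x (T x) = set_dist d A B"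
      "(\<forall>n. xs n \<in> A) \<and> xs 0 = x0 \<and> (\<forall>n. d (xs (Suc n)) (T (xs n)) = set_dist d A B)"
    then show "limitin (Metric_space.mtopology X d) xs x sequentially"
      by (intro best_proximity_point(2)[OF hyp]) auto
  qed
next
  fix X :: "'a set" and d A B T
  assume hyp: "best_proximity_hypotheses X d A B T"
  show "\<exists>!x. x \<in> A \<and> d x (T x) = set_dist d A B"
    using best_proximity_point(1)[OF hyp] .
  fix x x0
  assume "x \<in> A" "d x (T x) = set_dist d A B" "x0 \<in> proximal_left d A B"
  then show "limitin (Metric_space.mtopology X d) (\<lambda>n. (proximal_map d A B T ^^ n) x0) x sequentially"
    using best_proximity_point(3)[OF hyp] by (intro best_proximity_point(2)[OF hyp]) auto
qed

end
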